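(* For every odd $n\ge 3$ there exists an integer cyclically $3$-diagonal $\mathrm{H}_n(n;3)$.
   Context: A partially filled (p.f.) array is a matrix in which some cells may be empty. Let $n\ge k\ge 3$, let $t$ divide $2nk$, put $v=2nk+t$ and let $J$ be the subgroup of $\mathbb{Z}_v$ of order $t$. An $\mathrm{H}_t(n;k)$ (square relative Heffter array) is an $n\times n$ p.f. array with elements in $\mathbb{Z}_v$ such that each row and each column has exactly $k$ filled cells; for every $x\in\mathbb{Z}_v\setminus J$ either $x$ or $-x$ appears in the array; and the elements of every row and column sum to $0$. It is integer if moreover the elements of every row and column, viewed as integers in $\pm\{1,\dots,\lfloor\frac{2nk+t}{2}\rfloor\}$, sum to $0$ in $\mathbb{Z}$. For an $n\times n$ array and $i\in\{1,\dots,n\}$, the $i$-th diagonal is $D_i=\{(i,1),(i+1,2),\dots,(i-1,n)\}$, indices taken modulo $n$ in $\{1,\dots,n\}$. Diagonals $D_i,D_{i+1},\dots,D_{i+r}$ (indices mod $n$) are consecutive. A p.f. array of size $n\ge k$ is cyclically $k$-diagonal if its nonempty cells are exactly those of $k$ consecutive diagonals. *)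

theory Defs
  imports "HOL-Number_Theory.Residues"
begin

section \<open>Partially filled arrays\<close>

text \<open>
  An \<open>n \<times> n\<close> partially filled array is a function sending a cell (row, column) to
  its content, \<open>None\<close> meaning an empty cell. Rows and columns are numbered
  \<open>1, \<dots>, n\<close>; values outside this range are irrelevant, and every notion below only
  looks at cells in range.
\<close>

type_synonym 'a pf_array = "nat \<Rightarrow> nat \<Rightarrow> 'a option"

definition filled_cells :: "nat \<Rightarrow> 'a pf_array \<Rightarrow> (nat \<times> nat) set" where
  "filled_cells n A = {(i, j) \<in> {1..n} \<times> {1..n}. A i j \<noteq> None}"

definition row_cells :: "nat \<Rightarrow> 'a pf_array \<Rightarrow> nat \<Rightarrow> (nat \<times> nat) set" where
  "row_cells n A i = {c \<in> filled_cells n A. fst c = i}"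

definition col_cells :: "nat \<Rightarrow> 'a pf_array \<Rightarrow> nat \<Rightarrow> (nat \<times> nat) set" where
  "col_cells n A j = {c \<in> filled_cells n A. snd c = j}"

definition entry :: "'a pf_array \<Rightarrow> nat \<times> nat \<Rightarrow> 'a" where
  "entry A c = the (A (fst c) (snd c))"

definition entries :: "nat \<Rightarrow> 'a pf_array \<Rightarrow> 'a set" where
  "entries n A = entry A ` filled_cells n A"


section \<open>Cyclically diagonal arrays\<close>

text \<open>Reduction of a positive index modulo \<open>n\<close> to the range \<open>1, \<dots>, n\<close>.\<close>

definition wrap :: "nat \<Rightarrow> nat \<Rightarrow> nat" where
  "wrap n m = (m - 1) mod n + 1"

definition diagonal :: "nat \<Rightarrow> nat \<Rightarrow> (nat \<times> nat) set" where
  "diagonal n i = {(wrap n (i + (j - 1)), j) | j. j \<in> {1..n}}"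

definition cyclically_diagonal :: "nat \<Rightarrow> nat \<Rightarrow> 'a pf_array \<Rightarrow> bool" where
  "cyclically_diagonal n k A \<longleftrightarrow>
     n \<ge> k \<and> (\<exists>i\<in>{1..n}. filled_cells n A = (\<Union>r<k. diagonal n (wrap n (i + r))))"


section \<open>Relative Heffter arrays\<close>

abbreviation Zmod :: "nat \<Rightarrow> int ring" where
  "Zmod v \<equiv> residue_ring (int v)"

text \<open>The subgroup of order \<open>t\<close> of the cyclic group \<open>\<int>\<^sub>v\<close>; it exists and is unique whenever
  \<open>t\<close> divides \<open>v\<close>, see \<open>subgroup_of_order_eq\<close>.\<close>

definition subgroup_of_order :: "nat \<Rightarrow> nat \<Rightarrow> int set" where
  "subgroup_of_order v t = (THE J. subgroup J (add_monoid (Zmod v)) \<and> card J = t)"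

lemma add_monoid_pow_Zmod:
  assumes "v > 0"
  shows "x [^]\<^bsub>add_monoid (Zmod v)\<^esub> (k::nat) = (int k * x) mod int v"
proof (induction k)
  case (Suc k)
  then show ?case
    by (simp add: nat_pow_def residue_ring_def mod_simps algebra_simps)
qed (simp add: nat_pow_def residue_ring_def)

lemma multiples_subgroup:
  assumes "v > 1" "t dvd v"
  defines "H \<equiv> {x \<in> {0..<int v}. int (v div t) dvd x}"
  shows "subgroup H (add_monoid (Zmod v))" "card H = t"
proof -
  interpret residues "int v" "Zmod v"
    using assms(1) by unfold_locales auto
  from assms obtain d where d: "v = t * d" "t > 0" "d > 0" "v div t = d"
    by (metis dvd_mult_div_cancel gr0I mult_0 mult_0_right not_less_zero)
  have dv: "int d dvd int v"
    using d by simp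
  show "subgroup H (add_monoid (Zmod v))"
  proof (rule group.subgroupI[OF a_group])
    show "H \<subseteq> carrier (add_monoid (Zmod v))"
      by (auto simp: H_def residue_ring_def)
    show "H \<noteq> {}"
      using assms(1) by (auto simp: H_def intro!: exI[of _ 0])
  next
    fix x assume "x \<in> H"
    moreover have "inv\<^bsub>add_monoid (Zmod v)\<^esub> x = (- x) mod int v"
      using res_neg_eq by (simp add: a_inv_def)
    ultimately show "inv\<^bsub>add_monoid (Zmod v)\<^esub> x \<in> H"
      using assms(1) dv d by (auto simp: H_def dvd_mod_iff)
  next
    fix x y assume "x \<in> H" "y \<in> H"
    then show "x \<otimes>\<^bsub>add_monoid (Zmod v)\<^esub> y \<in> H"
      using assms(1) dv d by (auto simp: H_def dvd_mod_iff residue_ring_def)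
  qed
  have "H = (\<lambda>i. int d * int i) ` {..<t}"
  proof (intro equalityI subsetI)
    fix x assume x: "x \<in> H"
    then obtain q where q: "x = int d * q"
      using d by (auto simp: H_def)
    have "q \<ge> 0" "q < int t"
      using x q d by (auto simp: H_def zero_le_mult_iff mult.commute[of "int t"])
    then show "x \<in> (\<lambda>i. int d * int i) ` {..<t}"
      using q by (intro image_eqI[of _ _ "nat q"]) auto
  qed (use d in \<open>auto simp: H_def mult.commute[of "int t"]\<close>)
  moreover have "inj_on (\<lambda>i. int d * int i) {..<t}"
    using d by (auto simp: inj_on_def)
  ultimately show "card H = t"
    by (simp add: card_image)
qed

lemma subgroup_of_order_eq:
  assumes "v > 1" "t dvd v"
  shows "subgroup_of_order v t = {x \<in> {0..<int v}. int (v div t) dvd x}" (is "_ = ?H")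
  unfolding subgroup_of_order_def
proof (rule the_equality)
  show "subgroup ?H (add_monoid (Zmod v)) \<and> card ?H = t"
    using multiples_subgroup[OF assms] by simp
next
  interpret residues "int v" "Zmod v"
    using assms(1) by unfold_locales auto
  from assms obtain d where d: "v = t * d" "t > 0" "d > 0" "v div t = d"
    by (metis dvd_mult_div_cancel gr0I mult_0 mult_0_right not_less_zero)
  fix J assume J: "subgroup J (add_monoid (Zmod v)) \<and> card J = t"
  interpret JG: group "(add_monoid (Zmod v))\<lparr>carrier := J\<rparr>"
    using J subgroup.subgroup_is_group a_group by blast
  have "J \<subseteq> ?H"
  proof
    fix x assume x: "x \<in> J"
    have "x [^]\<^bsub>(add_monoid (Zmod v))\<lparr>carrier := J\<rparr>\<^esub> t = \<zero>\<^bsub>Zmod v\<^esub>"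
      using JG.pow_order_eq_1[of x] x J by (simp add: order_def)
    then have "x [^]\<^bsub>add_monoid (Zmod v)\<^esub> t = 0"
      by (simp add: nat_pow_def residue_ring_def)
    then have "int v dvd int t * x"
      using add_monoid_pow_Zmod[of v x t] assms by (simp add: mod_eq_0_iff_dvd)
    then have "int d dvd x"
      using d by simp
    moreover have "x \<in> carrier (Zmod v)"
      using J x subgroup.subset by fastforce
    ultimately show "x \<in> ?H"
      using d by (auto simp: residue_ring_def)
  qed
  then show "J = ?H"
    using J multiples_subgroup(2)[OF assms]
    by (intro card_subset_eq finite_subset[of ?H "{0..<int v}"]) auto
qed

text \<open>
  For \<open>v = 2nk + t\<close> there are \<open>nk\<close> filled cells and \<open>nk\<close> pairs \<open>{x, -x}\<close> in
  \<open>\<int>\<^sub>v \<setminus> J\<close>, so the alternative ``\<open>x\<close> or \<open>-x\<close> appears'' is automatically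
  exclusive, no element is repeated and no entry lies in \<open>J\<close>; we write it as an
  exclusive disjunction.
\<close>

definition heffter_array :: "nat \<Rightarrow> nat \<Rightarrow> nat \<Rightarrow> int pf_array \<Rightarrow> bool" where
  "heffter_array t n k A \<longleftrightarrow>
     3 \<le> k \<and> k \<le> n \<and> t dvd 2 * n * k \<and>
     (let v = 2 * n * k + t; J = subgroup_of_order v t in
        entries n A \<subseteq> carrier (Zmod v) \<and>
        (\<forall>i\<in>{1..n}. card (row_cells n A i) = k) \<and>
        (\<forall>j\<in>{1..n}. card (col_cells n A j) = k) \<and>
        (\<forall>x\<in>carrier (Zmod v) - J.
           (x \<in> entries n A) \<noteq> ((\<ominus>\<^bsub>Zmod v\<^esub> x) \<in> entries n A)) \<and>
        (\<forall>i\<in>{1..n}. (\<Oplus>\<^bsub>Zmod v\<^esub>c\<in>row_cells n A i. entry A c) = \<zero>\<^bsub>Zmod v\<^esub>) \<and>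
        (\<forall>j\<in>{1..n}. (\<Oplus>\<^bsub>Zmod v\<^esub>c\<in>col_cells n A j. entry A c) = \<zero>\<^bsub>Zmod v\<^esub>))"

text \<open>
  The representative of a residue \<open>x \<in> {0, \<dots>, v - 1}\<close> in
  \<open>\<plusminus>{1, \<dots>, \<lfloor>v/2\<rfloor>}\<close>. It is unique except for \<open>x = v/2\<close> and does not exist for
  \<open>x = 0\<close>; neither occurs in a Heffter array, as both lie in \<open>J\<close>.
\<close>

definition int_rep :: "nat \<Rightarrow> int \<Rightarrow> int" where
  "int_rep v x = (if x \<le> int (v div 2) then x else x - int v)"

definition integer_heffter_array :: "nat \<Rightarrow> nat \<Rightarrow> nat \<Rightarrow> int pf_array \<Rightarrow> bool" where
  "integer_heffter_array t n k A \<longleftrightarrow>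
     heffter_array t n k A \<and>
     (\<forall>i\<in>{1..n}. (\<Sum>c\<in>row_cells n A i. int_rep (2 * n * k + t) (entry A c)) = 0) \<and>
     (\<forall>j\<in>{1..n}. (\<Sum>c\<in>col_cells n A j. int_rep (2 * n * k + t) (entry A c)) = 0)"

end

theory Submission
  imports Defs
begin

text \<open>
  Write \<open>n = 2m + 1\<close>, so \<open>v = 7n\<close> and \<open>J\<close> consists of the multiples of \<open>7\<close>. As \<open>1, 2, 4\<close> are the
  nonzero squares modulo \<open>7\<close> and \<open>-1\<close> is not a square, it suffices that the entries are exactly the
  residues congruent to \<open>1, 2, 4\<close> modulo \<open>7\<close>. Placing \<open>7\<alpha>\<^sub>i + 1\<close> in cell \<open>(i, i)\<close>, \<open>7\<beta>\<^sub>i + 2\<close> in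
  \<open>(i, i + 1)\<close> and \<open>7\<beta>\<^sub>i - 3\<close> in \<open>(i + 1, i)\<close>, all rows and columns sum to zero iff
  \<open>\<alpha>\<^sub>i = -(\<beta>\<^sub>i + \<beta>\<^sub>i\<^sub>-\<^sub>1)\<close>. So one needs a cyclic ordering of \<open>-m, \<dots>, m\<close> whose sums of neighbours are
  again \<open>-m, \<dots>, m\<close>; the ordering \<open>0, -m, 1, 1 - m, 2, 2 - m, \<dots>, m\<close> works.
\<close>

section \<open>Sums in the residue ring and sums of integer representatives\<close>

lemma finsum_Zmod:
  assumes "v > 1" "finite S" "f ` S \<subseteq> carrier (Zmod v)"
  shows "(\<Oplus>\<^bsub>Zmod v\<^esub>x\<in>S. f x) = (\<Sum>x\<in>S. f x) mod int v"
proof -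
  interpret residues "int v" "Zmod v"
    using assms(1) by unfold_locales auto
  show ?thesis
    using assms(2,3)
  proof (induction S rule: finite_induct)
    case (insert x S)
    then have "f \<in> S \<rightarrow> carrier (Zmod v)" "f x \<in> carrier (Zmod v)"
      by auto
    with insert show ?case
      by (simp add: res_add_eq mod_simps)
  qed (simp add: res_zero_eq)
qed

lemma int_rep_cong: "[int_rep v x = x] (mod int v)"
  by (simp add: int_rep_def cong_iff_dvd_diff)

text \<open>For odd \<open>v\<close> the integers of absolute value at most \<open>v div 2\<close>
  form a complete residue system; for even \<open>v > 0\<close> the value \<open>-v/2\<close> would
  come back as \<open>v/2\<close>.\<close>

lemma int_rep_mod:
  assumes "odd v" "\<bar>x\<bar> \<le> int (v div 2)"
  shows "int_rep v (x mod int v) = x"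
proof -
  obtain w where w: "v = 2 * w + 1"
    using assms(1) by (auto elim: oddE)
  show ?thesis
  proof (cases "x \<ge> 0")
    case True
    with assms(2) w have "x mod int v = x" by (intro mod_pos_pos_trivial) auto
    with assms(2) show ?thesis by (simp add: int_rep_def)
  next
    case False
    with assms(2) w have "(x + int v) mod int v = x + int v"
      by (intro mod_pos_pos_trivial) auto
    with assms(2) w False show ?thesis by (simp add: int_rep_def)
  qed
qed

lemma finsum_Zmod_eq_0:
  assumes "v > 1" "finite S" "f ` S \<subseteq> carrier (Zmod v)" "(\<Sum>x\<in>S. int_rep v (f x)) = 0"
  shows "(\<Oplus>\<^bsub>Zmod v\<^esub>x\<in>S. f x) = \<zero>\<^bsub>Zmod v\<^esub>"
proof -
  have "[(\<Sum>x\<in>S. int_rep v (f x)) = (\<Sum>x\<in>S. f x)] (mod int v)"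
    by (intro cong_sum int_rep_cong)
  with assms(4) show ?thesis
    using assms(1-3) by (simp add: finsum_Zmod cong_def) (simp add: residue_ring_def)
qed

lemma finite_filled_cells: "finite (filled_cells n A)"
  unfolding filled_cells_def by (rule finite_subset[of _ "{1..n} \<times> {1..n}"]) auto

text \<open>Representatives are congruent to the entries, so vanishing integer sums already force
  the sums in the residue ring to vanish.\<close>

lemma integer_heffter_arrayI:
  assumes "v = 2 * n * k + t" "3 \<le> k" "k \<le> n" "t dvd 2 * n * k"
    and "entries n A \<subseteq> carrier (Zmod v)"
    and "\<And>i. i \<in> {1..n} \<Longrightarrow> card (row_cells n A i) = k"
    and "\<And>j. j \<in> {1..n} \<Longrightarrow> card (col_cells n A j) = k"
    and "\<And>x. x \<in> carrier (Zmod v) - subgroup_of_order v t \<Longrightarrow>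
           (x \<in> entries n A) \<noteq> ((\<ominus>\<^bsub>Zmod v\<^esub> x) \<in> entries n A)"
    and "\<And>i. i \<in> {1..n} \<Longrightarrow> (\<Sum>c\<in>row_cells n A i. int_rep v (entry A c)) = 0"
    and "\<And>j. j \<in> {1..n} \<Longrightarrow> (\<Sum>c\<in>col_cells n A j. int_rep v (entry A c)) = 0"
  shows "integer_heffter_array t n k A"
proof -
  have "v > 1"
    using assms(1-3) mult_le_mono[of 3 n 3 k] by linarith
  then have finsum_eq_0: "(\<Oplus>\<^bsub>Zmod v\<^esub>c\<in>S. entry A c) = \<zero>\<^bsub>Zmod v\<^esub>"
    if "S \<subseteq> filled_cells n A" "(\<Sum>c\<in>S. int_rep v (entry A c)) = 0" for S
    using that assms(5) finite_subset[OF that(1) finite_filled_cells]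
    by (intro finsum_Zmod_eq_0) (auto simp: entries_def)
  have rows: "(\<Oplus>\<^bsub>Zmod v\<^esub>c\<in>row_cells n A i. entry A c) = \<zero>\<^bsub>Zmod v\<^esub>" if "i \<in> {1..n}" for i
    by (rule finsum_eq_0[OF _ assms(9)[OF that]]) (auto simp: row_cells_def)
  have cols: "(\<Oplus>\<^bsub>Zmod v\<^esub>c\<in>col_cells n A j. entry A c) = \<zero>\<^bsub>Zmod v\<^esub>" if "j \<in> {1..n}" for j
    by (rule finsum_eq_0[OF _ assms(10)[OF that]]) (auto simp: col_cells_def)
  show ?thesis
    unfolding integer_heffter_array_def heffter_array_def Let_def assms(1)[symmetric]
    by (intro conjI ballI assms(2-) rows cols) assumption+
qed

section \<open>Construction of the array\<close>

definition cyc_suc :: "nat \<Rightarrow> nat \<Rightarrow> nat" where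
  "cyc_suc n i = (if i = n then 1 else i + 1)"

definition cyc_pred :: "nat \<Rightarrow> nat \<Rightarrow> nat" where
  "cyc_pred n i = (if i = 1 then n else i - 1)"

text \<open>The decreasing enumeration \<open>m, ..., -m\<close>, forced by the choice of
  \<open>beta\<close>.\<close>

definition alpha :: "nat \<Rightarrow> nat \<Rightarrow> int" where
  "alpha n i = (int n + 1) div 2 - int i"

text \<open>The ordering of \<open>-m, \<dots>, m\<close> from the introduction, shifted so that its initial \<open>0\<close> sits at \<open>i = n\<close>.\<close>

definition beta :: "nat \<Rightarrow> nat \<Rightarrow> int" where
  "beta n i = (if even i then int i div 2 else (int i - int n) div 2)"

text \<open>The class of 4 is written as \<open>-3\<close>: then \<open>1 + 2 - 3 = 0\<close>, and
  all entries stay within \<plusminus>(7m + 3), where \<open>7m + 3 = 7 * n div 2\<close>.\<close>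

definition int_array :: "nat \<Rightarrow> int pf_array" where
  "int_array n i j =
     (if j = i then Some (7 * alpha n i + 1)
      else if j = cyc_suc n i then Some (7 * beta n i + 2)
      else if i = cyc_suc n j then Some (7 * beta n j - 3)
      else None)"

definition mod_array :: "nat \<Rightarrow> int pf_array" where
  "mod_array n i j = map_option (\<lambda>x. x mod int (7 * n)) (int_array n i j)"

lemma filled_cells_mod_array:
  "filled_cells n (mod_array n) =
     {(i, j) \<in> {1..n} \<times> {1..n}. j = i \<or> j = cyc_suc n i \<or> i = cyc_suc n j}"
  by (auto simp: filled_cells_def mod_array_def int_array_def split: if_splits)

lemma row_cells_mod_array:
  assumes "i \<in> {1..n}"
  shows "row_cells n (mod_array n) i = {(i, i), (i, cyc_suc n i), (i, cyc_pred n i)}"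
  using assms by (auto simp: row_cells_def filled_cells_mod_array cyc_suc_def cyc_pred_def split: if_splits)

lemma col_cells_mod_array:
  assumes "j \<in> {1..n}"
  shows "col_cells n (mod_array n) j = {(j, j), (cyc_pred n j, j), (cyc_suc n j, j)}"
  using assms by (auto simp: col_cells_def filled_cells_mod_array cyc_suc_def cyc_pred_def split: if_splits)

text \<open>Distinctness of these indices keeps the three cases of \<open>int_array\<close> disjoint
  and gives each row and column three cells.\<close>

lemma cyc_suc_pred:
  assumes "n \<ge> 3" "i \<in> {1..n}"
  shows "cyc_suc n i \<noteq> i" "cyc_pred n i \<noteq> i" "cyc_suc n i \<noteq> cyc_pred n i"
    "cyc_suc n (cyc_pred n i) = i" "cyc_pred n (cyc_suc n i) = i"
    "cyc_suc n (cyc_suc n i) \<noteq> i" "cyc_pred n i \<in> {1..n}" "cyc_suc n i \<in> {1..n}"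
  using assms by (auto simp: cyc_suc_def cyc_pred_def split: if_splits)

lemma card_row_col_mod_array:
  assumes "n \<ge> 3" "i \<in> {1..n}"
  shows "card (row_cells n (mod_array n) i) = 3" "card (col_cells n (mod_array n) i) = 3"
  using cyc_suc_pred(1-3)[OF assms]
  by (auto simp: row_cells_mod_array[OF assms(2)] col_cells_mod_array[OF assms(2)] card_insert_if)

lemma int_array_simps:
  assumes "n \<ge> 3" "i \<in> {1..n}"
  shows "int_array n i i = Some (7 * alpha n i + 1)"
    "int_array n i (cyc_suc n i) = Some (7 * beta n i + 2)"
    "int_array n (cyc_suc n i) i = Some (7 * beta n i - 3)"
  using cyc_suc_pred[OF assms] by (auto simp: int_array_def)

text \<open>For \<open>i > 1\<close> the two indices have opposite parity, and both formulas for
  \<open>beta\<close> add up to \<open>i - (n + 1) div 2\<close>. The wrap-around at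
  \<open>i = 1\<close> joins two odd indices and fits because \<open>beta n n = 0\<close>.\<close>

lemma beta_add_beta_pred:
  assumes "odd n" "n \<ge> 3" "i \<in> {1..n}"
  shows "beta n i + beta n (cyc_pred n i) = - alpha n i"
  using assms by (cases "even i") (auto simp: beta_def alpha_def cyc_pred_def elim!: oddE evenE)

lemma abs_alpha_beta_le:
  assumes "odd n" "i \<in> {1..n}"
  shows "\<bar>alpha n i\<bar> \<le> int n div 2" "\<bar>beta n i\<bar> \<le> int n div 2"
  using assms by (auto simp: alpha_def beta_def elim!: oddE evenE)

lemma abs_int_array_le:
  assumes "odd n" "(i, j) \<in> {1..n} \<times> {1..n}" "int_array n i j = Some x"
  shows "\<bar>x\<bar> \<le> int (7 * n div 2)"
proof -
  obtain m where "n = 2 * m + 1" using assms(1) by (auto elim: oddE)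
  with assms abs_alpha_beta_le[OF assms(1), of i] abs_alpha_beta_le[OF assms(1), of j]
  show ?thesis by (auto simp: int_array_def split: if_splits)
qed

text \<open>By the bound on \<open>int_array\<close>, its values are themselves the representatives,
  so row and column sums can be computed there.\<close>

lemma int_rep_entry_mod_array:
  assumes "odd n" "c \<in> filled_cells n (mod_array n)"
  shows "int_rep (7 * n) (entry (mod_array n) c) = entry (int_array n) c"
proof -
  from assms(2) obtain x where "int_array n (fst c) (snd c) = Some x" "fst c \<in> {1..n}" "snd c \<in> {1..n}"
    by (auto simp: filled_cells_def mod_array_def)
  with abs_int_array_le[OF assms(1), of "fst c" "snd c" x] assms(1) int_rep_mod[of "7 * n" x]
  show ?thesis by (simp add: entry_def mod_array_def mem_Times_iff)
qed

lemma sum_row_mod_array: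
  assumes "odd n" "n \<ge> 3" "i \<in> {1..n}"
  shows "(\<Sum>c\<in>row_cells n (mod_array n) i. int_rep (7 * n) (entry (mod_array n) c)) = 0"
proof -
  have "(\<Sum>c\<in>row_cells n (mod_array n) i. int_rep (7 * n) (entry (mod_array n) c))
      = (\<Sum>c\<in>row_cells n (mod_array n) i. entry (int_array n) c)"
    using assms(1) by (intro sum.cong) (auto simp: row_cells_def int_rep_entry_mod_array)
  \<comment> \<open>The constants 1, 2, -3 cancel. The predecessor's \<open>beta\<close> sits below
    the diagonal here; in a column it sits above.\<close>
  also have "\<dots> = 7 * (alpha n i + beta n i + beta n (cyc_pred n i))"
    using cyc_suc_pred[OF assms(2,3)] int_array_simps[OF assms(2,3)]
      int_array_simps(3)[OF assms(2) cyc_suc_pred(7)[OF assms(2,3)]]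
    by (auto simp: row_cells_mod_array[OF assms(3)] entry_def algebra_simps)
  finally show ?thesis
    using beta_add_beta_pred[OF assms] by simp
qed

lemma sum_col_mod_array:
  assumes "odd n" "n \<ge> 3" "j \<in> {1..n}"
  shows "(\<Sum>c\<in>col_cells n (mod_array n) j. int_rep (7 * n) (entry (mod_array n) c)) = 0"
proof -
  have "(\<Sum>c\<in>col_cells n (mod_array n) j. int_rep (7 * n) (entry (mod_array n) c))
      = (\<Sum>c\<in>col_cells n (mod_array n) j. entry (int_array n) c)"
    using assms(1) by (intro sum.cong) (auto simp: col_cells_def int_rep_entry_mod_array)
  also have "\<dots> = 7 * (alpha n j + beta n j + beta n (cyc_pred n j))"
    using cyc_suc_pred[OF assms(2,3)] int_array_simps[OF assms(2,3)]
      int_array_simps(2)[OF assms(2) cyc_suc_pred(7)[OF assms(2,3)]]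
    by (auto simp: col_cells_mod_array[OF assms(3)] entry_def algebra_simps)
  finally show ?thesis
    using beta_add_beta_pred[OF assms] by simp
qed

section \<open>The set of entries\<close>

lemma alpha_surj:
  assumes "odd n" "\<bar>q\<bar> \<le> int n div 2"
  shows "\<exists>i\<in>{1..n}. alpha n i = q"
  using assms by (intro bexI[of _ "nat ((int n + 1) div 2 - q)"]) (auto simp: alpha_def elim!: oddE)

text \<open>Even indices \<open>2 * q\<close> yield the values 1, ..., m; odd indices
  \<open>n + 2 * q\<close> yield -m, ..., 0.\<close>

lemma beta_surj:
  assumes "odd n" "\<bar>q\<bar> \<le> int n div 2"
  shows "\<exists>i\<in>{1..n}. beta n i = q"
proof (cases "q > 0")
  case True
  with assms show ?thesis
    by (intro bexI[of _ "2 * nat q"]) (auto simp: beta_def elim!: oddE)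
next
  case False
  with assms have "odd (n - 2 * nat (- q))" "2 * nat (- q) < n"
    by (auto elim!: oddE)
  with False show ?thesis
    by (intro bexI[of _ "n - 2 * nat (- q)"]) (auto simp: beta_def of_nat_diff)
qed

lemma entry_in_entries:
  assumes "i \<in> {1..n}" "j \<in> {1..n}" "int_array n i j = Some x"
  shows "x mod int (7 * n) \<in> entries n (mod_array n)"
  using assms
  by (auto simp: entries_def entry_def filled_cells_def mod_array_def intro!: image_eqI[of _ _ "(i, j)"])

text \<open>Reduction modulo \<open>7 * n\<close> preserves classes modulo 7. Conversely, the class
  of an element selects the diagonal, and its quotient by 7 is hit by \<open>alpha\<close> or
  \<open>beta\<close>.\<close>

lemma entries_mod_array:
  assumes "odd n" "n \<ge> 3"
  shows "entries n (mod_array n) = {x \<in> {0..<int (7 * n)}. x mod 7 \<in> {1, 2, 4}}"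
proof (intro equalityI subsetI)
  fix y assume "y \<in> entries n (mod_array n)"
  then obtain i j x where x: "int_array n i j = Some x" "y = x mod int (7 * n)"
    by (auto simp: entries_def entry_def filled_cells_def mod_array_def)
  from x(1) have "x mod 7 \<in> {1, 2, 4}"
    by (auto simp: int_array_def split: if_splits) presburger+
  moreover have "y mod 7 = x mod 7"
    unfolding x(2) by (simp add: mod_mod_cancel)
  ultimately show "y \<in> {x \<in> {0..<int (7 * n)}. x mod 7 \<in> {1, 2, 4}}"
    using x(2) assms(2) by simp
next
  fix y assume y: "y \<in> {x \<in> {0..<int (7 * n)}. x mod 7 \<in> {1, 2, 4}}"
  define x where "x = (if y \<le> int (7 * n div 2) then y else y - int (7 * n))"
  have xy: "x mod int (7 * n) = y"
    using y by (auto simp: x_def mod_pos_pos_trivial)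
  have "x mod 7 = y mod 7"
    unfolding xy[symmetric] by (simp add: mod_mod_cancel)
  moreover obtain m where m: "n = 2 * m + 1" using assms(1) by (auto elim: oddE)
  have x: "\<bar>x\<bar> \<le> 7 * int m + 3"
    using y m by (auto simp: x_def)
  consider "x mod 7 = 1" | "x mod 7 = 2" | "x mod 7 = 4"
    using y calculation by auto
  then obtain i j where "i \<in> {1..n}" "j \<in> {1..n}" "int_array n i j = Some x"
  proof cases
    case 1
    then have "x = 7 * (x div 7) + 1" by presburger
    moreover from this x m have "\<bar>x div 7\<bar> \<le> int n div 2" by auto
    ultimately show ?thesis
      using that alpha_surj[OF assms(1)] int_array_simps(1)[OF assms(2)] by metis
  next
    case 2
    then have "x = 7 * (x div 7) + 2" by presburger
    moreover from this x m have "\<bar>x div 7\<bar> \<le> int n div 2" by auto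
    ultimately show ?thesis
      using that beta_surj[OF assms(1)] int_array_simps(2)[OF assms(2)] cyc_suc_pred(8)[OF assms(2)] by metis
  next
    case 3
    \<comment> \<open>Since 4 is written as \<open>-3\<close>, the quotient must be shifted:
      \<open>x div 7\<close> is one too small and reaches \<open>-m - 1\<close>.\<close>
    then have "x = 7 * ((x + 3) div 7) - 3" by presburger
    moreover from this x m have "\<bar>(x + 3) div 7\<bar> \<le> int n div 2" by auto
    ultimately show ?thesis
      using that beta_surj[OF assms(1)] int_array_simps(3)[OF assms(2)] cyc_suc_pred(8)[OF assms(2)] by metis
  qed
  then show "y \<in> entries n (mod_array n)"
    using entry_in_entries xy by metis
qed

section \<open>Diagonal structure\<close>

lemma wrap_add_1: "i \<in> {1..n} \<Longrightarrow> wrap n (i + 1) = cyc_suc n i"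
  by (auto simp: wrap_def cyc_suc_def)

lemma wrap_add_pred:
  assumes "j \<in> {1..n}"
  shows "wrap n (n + (j - 1)) = cyc_pred n j"
proof (cases "j = 1")
  case False
  with assms obtain k where "j = k + 2"
    using that[of "j - 2"] by auto
  with assms show ?thesis by (simp add: wrap_def cyc_pred_def)
qed (use assms in \<open>auto simp: wrap_def cyc_pred_def\<close>)

text \<open>The cells above, on and below the main diagonal form, cyclically, the diagonals with
  indices \<open>n\<close>, 1, 2, so the run starts at \<open>n\<close>.\<close>

lemma cyclically_diagonal_mod_array:
  assumes "n \<ge> 3"
  shows "cyclically_diagonal n 3 (mod_array n)"
proof -
  have "diagonal n 1 = {(j, j) | j. j \<in> {1..n}}"
    by (auto simp: diagonal_def wrap_def)
  moreover have "diagonal n 2 = {(cyc_suc n j, j) | j. j \<in> {1..n}}"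
    unfolding diagonal_def by (intro Collect_cong ex_cong1) (auto simp flip: wrap_add_1)
  moreover have "diagonal n n = {(cyc_pred n j, j) | j. j \<in> {1..n}}"
    unfolding diagonal_def using wrap_add_pred[of _ n] by (intro Collect_cong ex_cong1) auto
  moreover have "filled_cells n (mod_array n) =
      {(cyc_pred n j, j) | j. j \<in> {1..n}} \<union> {(j, j) | j. j \<in> {1..n}} \<union> {(cyc_suc n j, j) | j. j \<in> {1..n}}"
  proof -
    have "j = cyc_suc n i \<longleftrightarrow> i = cyc_pred n j" if "i \<in> {1..n}" "j \<in> {1..n}" for i j
      using cyc_suc_pred(4,5)[OF assms] that by metis
    then show ?thesis
      unfolding filled_cells_mod_array using cyc_suc_pred(7,8)[OF assms] by blast
  qed
  ultimately have "filled_cells n (mod_array n) = diagonal n n \<union> diagonal n 1 \<union> diagonal n 2"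
    by metis
  moreover have "wrap n n = n" "wrap n (n + 1) = 1" "wrap n (n + 2) = 2"
    using assms by (auto simp: wrap_def mod_Suc)
  then have "(\<Union>r<3. diagonal n (wrap n (n + r))) = diagonal n n \<union> diagonal n 1 \<union> diagonal n 2"
    by (simp add: numeral_3_eq_3 lessThan_Suc Un_ac)
  ultimately show ?thesis
    using assms by (auto simp: cyclically_diagonal_def intro!: bexI[of _ n])
qed

theorem proposition4p1:
  fixes n :: nat
  assumes "odd n" and "n \<ge> 3"
  shows "\<exists>A. integer_heffter_array n n 3 A \<and> cyclically_diagonal n 3 A"
proof (intro exI conjI)
  interpret residues "int (7 * n)" "Zmod (7 * n)"
    using assms by unfold_locales auto
  have carrier: "carrier (Zmod (7 * n)) = {0..<int (7 * n)}"
    by (auto simp: residue_ring_def)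
  show "integer_heffter_array n n 3 (mod_array n)"
  proof (rule integer_heffter_arrayI[where v = "7 * n"])
    fix x assume x: "x \<in> carrier (Zmod (7 * n)) - subgroup_of_order (7 * n) n"
    \<comment> \<open>The subgroup consists of the multiples of
      \<open>7 * n div n = 7\<close>.\<close>
    then have "x mod 7 \<noteq> 0"
      using assms carrier by (auto simp: subgroup_of_order_eq)
    \<comment> \<open>Negation modulo 7 exchanges {1, 2, 4} with {3, 5, 6}.\<close>
    then have "(x mod 7 \<in> {1, 2, 4}) \<noteq> ((- x) mod 7 \<in> {1, 2, 4})"
      unfolding insert_iff empty_iff by presburger
    moreover have "\<ominus>\<^bsub>Zmod (7 * n)\<^esub> x = (- x) mod int (7 * n)"
      by (rule res_neg_eq)
    ultimately show "(x \<in> entries n (mod_array n)) \<noteq> ((\<ominus>\<^bsub>Zmod (7 * n)\<^esub> x) \<in> entries n (mod_array n))"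
      using x carrier assms by (simp add: entries_mod_array mod_mod_cancel)
  next
    show "entries n (mod_array n) \<subseteq> carrier (Zmod (7 * n))"
      unfolding carrier entries_mod_array[OF assms] by blast
  qed (use assms(2) card_row_col_mod_array[OF assms(2)] sum_row_mod_array[OF assms]
      sum_col_mod_array[OF assms] in \<open>(assumption | simp)+\<close>)
  show "cyclically_diagonal n 3 (mod_array n)"
    using assms(2) by (rule cyclically_diagonal_mod_array)
qed

end
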